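(* Let $G$ be an oriented unicyclic graph on $n\ge 2$ vertices $1,\dots,n$ with edges $e_1,\dots,e_n$, with even cycle $C$, non-zero edge weights in $\mathbb{C}\setminus\mathbb{R}^-$, and complex signless incidence matrix $N$. Suppose $wt(C)\in\mathbb{C}\setminus\mathbb{R}^+$. Define the $n\times n$ matrix $F=(f_{ij})$ by, for $e_i=(u,v)$, $$f_{ij}=\begin{cases}(-1)^{d^*(j,u)}\dfrac{\frac{wt(\gamma_{u\to j})}{|wt(\gamma_{u\to j})|}}{\sqrt{\overline{w_{uv}}}\left(\frac{w_{uv}}{|w_{uv}|}-\frac{wt(\gamma_{u\to v})}{|wt(\gamma_{u\to v})|}\right)} & \text{if } e_i\in C,\\[3mm] 0 & \text{if } e_i\notin C,\ j\in G\setminus e_i[C],\\[1mm] (-1)^{d^*(j,u)}\dfrac{1}{\sqrt{w_{uv}}}\dfrac{|wt(\gamma_{j\to u})|}{wt(\gamma_{j\to u})} & \text{if } e_i\notin C,\ j\in G\setminus(e_i,u](C),\\[3mm] (-1)^{d^*(j,v)}\dfrac{1}{\sqrt{\overline{w_{uv}}}}\dfrac{|wt(\gamma_{j\to v})|}{wt(\gamma_{j\to v})} & \text{if } e_i\notin C,\ j\in G\setminus(e_i,v](C).\end{cases}$$ Then $F$ is the Moore--Penrose inverse of $N$.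
   Context: An oriented graph $G$ is obtained from a finite simple undirected graph $G_u$ (its underlying graph) by giving each edge exactly one direction. It is unicyclic if $G_u$ is connected and has exactly one cycle (so it has as many edges as vertices). Each directed edge $(u,v)$ (from $u$ to $v$) has a non-zero complex weight $w_{uv}$. $\mathbb{R}^+$ and $\mathbb{R}^-$ denote the positive and the negative real numbers, and $\sqrt{\cdot}$ is the principal square root. The complex signless incidence matrix $N=(n_{ij})$ (rows indexed by vertices, columns by edges) is given, for $e_j=(u,v)$, by $n_{ij}=\sqrt{w_{uv}}$ if $i=u$, $n_{ij}=\sqrt{\overline{w_{uv}}}$ if $i=v$, and $n_{ij}=0$ otherwise. Put $a_{ij}=w_{ij}$ if $(i,j)\in E(G)$, $a_{ij}=\overline{w_{ji}}$ if $(j,i)\in E(G)$, and $a_{ij}=0$ otherwise. The weight of a walk $\gamma=(i_1,\dots,i_k)$ in $G_u$ is $wt(\gamma)=\prod_{s=1}^{k-1}a_{i_si_{s+1}}$ (so a trivial one-vertex walk has weight $1$). $wt(C)$ is the weight of the closed walk going once around $C$ in either direction (the two directions give complex conjugate values, so the condition on $wt(C)$ does not depend on the choice). A cycle is even if its length is even. If $e_i=(u,v)\notin C$, removing $e_i$ from $G$ leaves two components: a unicyclic one, denoted $G\setminus e_i[C]$, and a tree; the tree is denoted $G\setminus(e_i,u](C)$ if it contains $u$ and $G\setminus(e_i,v](C)$ if it contains $v$. For vertices $s,r$, $d^*(s,r)$ and $\gamma_{s\to r}$ denote the distance and the unique walk without repeated vertices from $s$ to $r$ in the underlying graph of $G$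 with $e_i$ removed (if $e_i\in C$ this is a tree; if $e_i\notin C$ they are only used inside its tree component). *)

theory Defs
  imports "HOL-Analysis.Analysis" "Graph_Theory.Graph_Theory"
begin

definition oriented_graph :: "'v pair_pre_digraph \<Rightarrow> bool" where
  "oriented_graph G \<longleftrightarrow> pair_digraph G \<and> (\<forall>u v. (u, v) \<in> parcs G \<longrightarrow> (v, u) \<notin> parcs G)"

text \<open>
  The underlying graph is represented by the symmetric digraph on the same vertices.
  A walk \<open>(i\<^sub>1, \<dots>, i\<^sub>k)\<close> in it is an arc walk, i.e. the list of pairs
  \<open>[(i\<^sub>1, i\<^sub>2), \<dots>, (i\<^sub>k\<^sub>-\<^sub>1, i\<^sub>k)]\<close>; the one-vertex walk is the empty list.
\<close>

abbreviation underlying :: "('v, 'b) pre_digraph \<Rightarrow> ('v, 'v \<times> 'v) pre_digraph" where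
  "underlying H \<equiv> with_proj (mk_symmetric H)"

text \<open>
  In a symmetric digraph, going back and forth along one edge is also a \<^const>\<open>pre_digraph.cycle\<close>,
  of length 2; the length condition excludes it.
\<close>

definition graph_cycle :: "('v, 'b) pre_digraph \<Rightarrow> ('v \<times> 'v) list \<Rightarrow> bool" where
  "graph_cycle H c \<longleftrightarrow> pre_digraph.cycle (underlying H) c \<and> 3 \<le> length c"

definition edges_of :: "('v \<times> 'v) list \<Rightarrow> 'v set set" where
  "edges_of p = (\<lambda>(x, y). {x, y}) ` set p"

text \<open>
  Closed walks that differ only in starting point or direction are the same cycle of the
  graph, so cycles are counted by their sets of undirected edges.
\<close>

definition unicyclic :: "('v, 'b) pre_digraph \<Rightarrow> bool" where
  "unicyclic H \<longleftrightarrow>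
     Digraph_Component.connected H \<and> (\<exists>!C. \<exists>c. graph_cycle H c \<and> C = edges_of c)"

definition dist_in :: "('v, 'b) pre_digraph \<Rightarrow> 'v \<Rightarrow> 'v \<Rightarrow> nat" where
  "dist_in H s r = (LEAST k. \<exists>p. pre_digraph.awalk (underlying H) s p r \<and> length p = k)"

definition path_in :: "('v, 'b) pre_digraph \<Rightarrow> 'v \<Rightarrow> 'v \<Rightarrow> ('v \<times> 'v) list" where
  "path_in H s r = (THE p. pre_digraph.apath (underlying H) s p r)"

definition component_of :: "('v, 'b) pre_digraph \<Rightarrow> 'v \<Rightarrow> ('v, 'b) pre_digraph" where
  "component_of H x = H \<restriction> pre_digraph.scc_of (underlying H) x"

definition adj_weight :: "'v pair_pre_digraph \<Rightarrow> ('v \<times> 'v \<Rightarrow> complex) \<Rightarrow> 'v \<Rightarrow> 'v \<Rightarrow> complex" where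
  "adj_weight G w i j =
     (if (i, j) \<in> parcs G then w (i, j) else if (j, i) \<in> parcs G then cnj (w (j, i)) else 0)"

definition walk_weight ::
    "'v pair_pre_digraph \<Rightarrow> ('v \<times> 'v \<Rightarrow> complex) \<Rightarrow> ('v \<times> 'v) list \<Rightarrow> complex" where
  "walk_weight G w p = prod_list (map (\<lambda>(i, j). adj_weight G w i j) p)"

text \<open>
  Edges are enumerated by a map \<open>e\<close> from an index type; in \<open>A $ i $ j\<close>, \<open>i\<close> is the row
  and \<open>j\<close> the column.
\<close>

definition signless_incidence ::
    "('e::finite \<Rightarrow> 'v \<times> 'v) \<Rightarrow> ('v \<times> 'v \<Rightarrow> complex) \<Rightarrow> complex ^ 'e ^ 'v::finite" where
  "signless_incidence e w = (\<chi> i j. case e j of (u, v) \<Rightarrow>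
     if i = u then csqrt (w (u, v))
     else if i = v then csqrt (cnj (w (u, v)))
     else 0)"

text \<open>
  The matrix \<open>F\<close>. The closed walk \<open>c\<close> goes once around the cycle of \<open>G\<close>. If the edge
  \<open>e i = (u, v)\<close> is not on it, then \<open>G\<close> without \<open>e i\<close> has two components, one unicyclic and the
  other a tree containing exactly one of \<open>u\<close> and \<open>v\<close>; hence the last branch is the case
  that \<open>j\<close> lies in a tree component containing \<open>v\<close>.
\<close>

definition F_matrix ::
    "'v pair_pre_digraph \<Rightarrow> ('v \<times> 'v \<Rightarrow> complex) \<Rightarrow> ('e::finite \<Rightarrow> 'v \<times> 'v) \<Rightarrow> ('v \<times> 'v) list
      \<Rightarrow> complex ^ 'v::finite ^ 'e" where
  "F_matrix G w e c = (\<chi> i j. case e i of (u, v) \<Rightarrow>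
     let H = pre_digraph.del_arc (with_proj G) (u, v);
         d = dist_in H;
         wt = (\<lambda>s r. walk_weight G w (path_in H s r))
     in
       if {u, v} \<in> edges_of c then
         (-1) ^ d j u *
           ((wt u j / complex_of_real (cmod (wt u j))) /
            (csqrt (cnj (w (u, v))) *
              (w (u, v) / complex_of_real (cmod (w (u, v)))
                - wt u v / complex_of_real (cmod (wt u v)))))
       else if unicyclic (component_of H j) then 0
       else if u \<in> verts (component_of H j) then
         (-1) ^ d j u * (1 / csqrt (w (u, v))) * (complex_of_real (cmod (wt j u)) / wt j u)
       else
         (-1) ^ d j v * (1 / csqrt (cnj (w (u, v)))) * (complex_of_real (cmod (wt j v)) / wt j v))"

definition conj_transpose :: "complex ^ 'm ^ 'n \<Rightarrow> complex ^ 'n ^ 'm" where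
  "conj_transpose A = (\<chi> i j. cnj (A $ j $ i))"

definition is_moore_penrose_inverse ::
    "complex ^ 'm::finite ^ 'n::finite \<Rightarrow> complex ^ 'n ^ 'm \<Rightarrow> bool" where
  "is_moore_penrose_inverse A X \<longleftrightarrow>
     A ** X ** A = A \<and> X ** A ** X = X \<and>
     conj_transpose (A ** X) = A ** X \<and> conj_transpose (X ** A) = X ** A"

lemma conj_transpose_mult: "conj_transpose (A ** B) = conj_transpose B ** conj_transpose A"
  by (simp add: conj_transpose_def matrix_matrix_mult_def vec_eq_iff mult.commute)

lemma moore_penrose_inverse_unique:
  assumes "is_moore_penrose_inverse A X" and "is_moore_penrose_inverse A Y"
  shows "X = Y"
proof -
  note X = assms(1)[unfolded is_moore_penrose_inverse_def]
  note Y = assms(2)[unfolded is_moore_penrose_inverse_def]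
  have "A ** X = conj_transpose (A ** Y ** (A ** X))"
    using X Y by (simp add: matrix_mul_assoc)
  also have "\<dots> = A ** X ** (A ** Y)"
    using X Y by (simp add: conj_transpose_mult)
  also have "\<dots> = A ** Y"
    using X by (simp add: matrix_mul_assoc)
  finally have AX: "A ** X = A ** Y" .
  have "X ** A = conj_transpose (X ** A ** (Y ** A))"
    using X Y by (simp add: conj_transpose_mult matrix_mul_assoc)
       (metis matrix_mul_assoc)
  also have "\<dots> = X ** A ** (Y ** A)"
    using X Y by (metis matrix_mul_assoc conj_transpose_mult)
  finally show ?thesis
    using AX X Y by (metis matrix_mul_assoc conj_transpose_mult)
qed

end

theory Submission
  imports Defs
begin

text \<open>
  Since \<open>N\<close> is square, it suffices to show \<open>F N = 1\<close>. Up to a constant factor, the \<open>i\<close>-th row of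
  \<open>F\<close> is, on each tree component of \<open>G\<close> minus \<open>e i\<close> (and \<open>0\<close> on the unicyclic one), the function
  sending \<open>j\<close> to the product of \<open>- a x y / \<bar>a x y\<bar>\<close> over the arcs \<open>(x, y)\<close> of the path from an end
  of \<open>e i\<close> to \<open>j\<close>. As \<open>sqrt w = (w / \<bar>w\<bar>) * cnj (sqrt w)\<close> off the negative real axis, such a
  function is annihilated by the column of every edge of the tree. What remains is the column of
  \<open>e i\<close>, where the constant factor normalises the product to \<open>1\<close>; if \<open>e i\<close> lies on the even cycle,
  this is possible because the weight of the cycle is not a positive real.
\<close>

section \<open>Cycles and unique paths in symmetric digraphs\<close>

context pair_bidirected_digraph
begin

text \<open>A path that avoids \<open>s\<close> is closed up through \<open>s\<close>. As
  \<open>x \<noteq> y\<close>, the path has at least one arc, so the result is not merely an edge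
  traversed back and forth.\<close>

lemma cycle_through_vertex:
  assumes q: "apath x q y" and s: "s \<notin> set (pawalk_verts x q)" and "x \<noteq> y"
    and arcs: "(s, x) \<in> parcs G" "(y, s) \<in> parcs G"
  shows "awalk s ((s, x) # q @ [(y, s)]) s" "cycle ((s, x) # q @ [(y, s)])"
    "3 \<le> length ((s, x) # q @ [(y, s)])"
proof -
  have "awalk x q y" "awalk y [(y, s)] s"
    using q arcs by (simp_all add: apath_def awalk_simps wellformed')
  then have w: "awalk x (q @ [(y, s)]) s"
    by (rule awalk_appendI)
  show aw: "awalk s ((s, x) # q @ [(y, s)]) s"
    using w arcs by (simp add: awalk_Cons_iff del: awalk_append_iff)
  have "pawalk_verts x (q @ [(y, s)]) = pawalk_verts x q @ [s]"
    using awalk_verts_append[OF w] by simp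
  then have "distinct (tl (pawalk_verts s ((s, x) # q @ [(y, s)])))"
    using q s by (simp add: apath_def)
  with aw show "cycle ((s, x) # q @ [(y, s)])"
    unfolding cycle_def by blast
  have "q \<noteq> []"
    using q \<open>x \<noteq> y\<close> by (auto simp: apath_def awalk_Nil_iff)
  then show "3 \<le> length ((s, x) # q @ [(y, s)])"
    by (cases q) auto
qed

text \<open>The component of \<open>s\<close> is a tree. Cycles of length 2 are tolerated because an
  arc and its reverse form one in a symmetric digraph.\<close>

definition tree_at :: "'a \<Rightarrow> bool" where
  "tree_at s \<longleftrightarrow> (\<forall>x c. s \<rightarrow>\<^sup>*\<^bsub>with_proj G\<^esub> x \<longrightarrow> awalk x c x \<longrightarrow> cycle c \<longrightarrow> length c < 3)"

lemma tree_at_reachable: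
  assumes "tree_at s" "s \<rightarrow>\<^sup>*\<^bsub>with_proj G\<^esub> x"
  shows "tree_at x"
  using assms reachable_trans unfolding tree_at_def by blast

text \<open>Induction along the first path. If the two paths left \<open>s\<close> by different
  arcs, joining their remainders would give a walk between the two neighbours that avoids
  \<open>s\<close>, hence a cycle of length at least 3 through \<open>s\<close>.\<close>

lemma apath_unique:
  assumes "tree_at s" "apath s p r" "apath s q r"
  shows "p = q"
  using assms
proof (induction p arbitrary: s q)
  case Nil
  then show ?case
    using apath_nonempty_ends by (auto simp: apath_Nil_iff)
next
  case (Cons a p)
  obtain x where a: "a = (s, x)"
    using Cons.prems(2) by (cases a) (auto simp: apath_Cons_iff)
  have "s \<noteq> r"
    using apath_nonempty_ends[OF Cons.prems(2)] by simp
  then obtain y q' where q: "q = (s, y) # q'"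
    using Cons.prems(3) by (cases q) (auto simp: apath_simps)
  have p': "apath x p r" "s \<notin> set (pawalk_verts x p)" "(s, x) \<in> parcs G"
    and q': "apath y q' r" "s \<notin> set (pawalk_verts y q')" "(s, y) \<in> parcs G"
    using Cons.prems(2,3) by (auto simp: a q apath_Cons_iff)
  have "x = y"
  proof (rule ccontr)
    assume "x \<noteq> y"
    have walk: "awalk x (p @ rev_path q') y"
      using p' q' by (intro awalk_appendI) (auto simp: apath_def)
    have avoid: "s \<notin> set (pawalk_verts x (p @ rev_path q'))"
      using p' q' set_awalk_verts_append[of x p r "rev_path q'" y] awalk_verts_rev_path[of y q' r]
      by (auto simp: apath_def)
    \<comment> \<open>Shortening the walk to a path only drops vertices, so \<open>s\<close> is
      still avoided.\<close>
    let ?t = "awalk_to_apath (p @ rev_path q')"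
    have t: "apath x ?t y"
      by (rule apath_awalk_to_apath[OF walk])
    have "s \<notin> set (pawalk_verts x ?t)"
      using avoid awalk_to_apath_subset[OF walk] set_awalk_verts[OF walk]
        set_awalk_verts[of x ?t y] t by (auto simp: apath_def)
    from cycle_through_vertex[OF t this \<open>x \<noteq> y\<close> p'(3)] q'(3)
    have "\<exists>c. awalk s c s \<and> cycle c \<and> 3 \<le> length c"
      using arcs_symmetric by blast
    moreover have "s \<rightarrow>\<^sup>*\<^bsub>with_proj G\<^esub> s"
      using p'(3) by (auto simp: wellformed')
    ultimately show False
      using \<open>tree_at s\<close> unfolding tree_at_def by (meson not_less)
  qed
  moreover have "tree_at x"
    using tree_at_reachable[OF \<open>tree_at s\<close>] p'(3) by auto
  ultimately show ?case
    using Cons.IH[of x q'] p' q' by (simp add: a q)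
qed

lemma the_apath:
  assumes "tree_at s" "apath s p r"
  shows "(THE p. apath s p r) = p"
  using assms apath_unique by (intro the_equality) blast+

lemma length_awalk_to_apath: "awalk u p v \<Longrightarrow> length (awalk_to_apath p) \<le> length p"
proof (induct rule: awalk_to_apath_induct)
  case (path p)
  then have "awalk_to_apath p = p"
    by (auto simp: awalk_to_apath.simps)
  then show ?case by simp
next
  case (decomp p q r s)
  from awalk_cyc_decompE[OF decomp(2,1,3)] have "p = q @ r @ s" by blast
  then show ?case
    using decomp step_awalk_to_apath[of u p v q r s] by simp
qed

text \<open>Every walk shortens to a path, and in a tree that path can only be
  \<open>p\<close>.\<close>

lemma Least_length_awalk:
  assumes "tree_at s" "apath s p r"
  shows "(LEAST k. \<exists>q. awalk s q r \<and> length q = k) = length p"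
proof (rule Least_equality)
  show "\<exists>q. awalk s q r \<and> length q = length p"
    using assms by (auto simp: apath_def)
next
  fix k
  assume "\<exists>q. awalk s q r \<and> length q = k"
  then obtain q where q: "awalk s q r" "length q = k" by blast
  then show "length p \<le> k"
    using apath_unique[OF assms apath_awalk_to_apath[OF q(1)]] length_awalk_to_apath[OF q(1)]
    by simp
qed

text \<open>Crossing an arc either prolongs the path from the root or undoes its last step: if
  \<open>y\<close> already lies on \<open>p\<close>, the part of \<open>p\<close> from
  \<open>y\<close> to \<open>x\<close> is the single arc, by uniqueness of paths.\<close>

lemma apath_arc_cases:
  assumes "tree_at s" "apath s p x" "(x, y) \<in> parcs G"
  obtains "apath s (p @ [(x, y)]) y" | q where "apath s q y" "p = q @ [(y, x)]"
proof (cases "y \<in> set (pawalk_verts s p)")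
  case False
  have "x \<noteq> y"
    using assms(3) pair_no_loops by fastforce
  then have "apath x [(x, y)] y"
    using assms(3) by (simp add: apath_simps wellformed')
  then have "apath s (p @ [(x, y)]) y"
    using assms(2) False by (auto simp: apath_append_iff dest: awalkI_apath)
  then show ?thesis by (rule that)
next
  case True
  then obtain q r where p: "p = q @ r" "awalk s q y" "awalk y r x"
    using awalk_decomp[of s p x y] assms(2) by (auto simp: apath_def)
  then have qr: "apath s q y" "apath y r x"
    using assms(2) by (auto simp: apath_append_iff)
  have "apath y [(y, x)] x"
    using assms(3) arcs_symmetric pair_no_loops by (fastforce simp: apath_simps wellformed')
  moreover have "tree_at y"
    using tree_at_reachable[OF assms(1)] p(2) by (auto simp: reachable_awalk)
  ultimately have "r = [(y, x)]"
    using qr(2) apath_unique by blast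
  then show ?thesis
    using that(2) p(1) qr(1) by blast
qed

text \<open>The cycle is rotated to start just after the arc; without the arc no vertex is
  repeated.\<close>

lemma cycle_minus_arc:
  assumes "cycle (p1 @ (x, y) # p2)"
  shows "apath y (p2 @ p1) x"
proof -
  obtain u where u: "awalk u (p1 @ (x, y) # p2) u"
      "distinct (tl (pawalk_verts u (p1 @ (x, y) # p2)))"
    using assms unfolding cycle_def by auto
  from u(1) have w: "awalk u p1 x" "awalk y p2 u"
    by (auto simp: awalk_Cons_iff)
  then have aw: "awalk y (p2 @ p1) x" by (rule awalk_appendI[rotated])
  have "pawalk_verts u (p1 @ (x, y) # p2) = pawalk_verts u p1 @ pawalk_verts y p2"
    using awalk_verts_append[OF u(1)] w by simp
  moreover have "pawalk_verts y (p2 @ p1) = pawalk_verts y p2 @ tl (pawalk_verts u p1)"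
    using awalk_verts_append[OF aw] w by simp
  moreover have "pawalk_verts u p1 \<noteq> []"
    by (cases p1) auto
  ultimately have "distinct (pawalk_verts y (p2 @ p1))"
    using u(2) by (auto simp: tl_append2)
  with aw show ?thesis by (simp add: apath_def)
qed

text \<open>The pieces of \<open>p\<close> before and after the arc are paths from a vertex to
  itself, hence empty.\<close>

lemma apath_containing_arc:
  assumes "apath x p y" "(x, y) \<in> set p"
  shows "p = [(x, y)]"
proof -
  obtain p1 p2 where p: "p = p1 @ (x, y) # p2"
    using assms(2) by (meson split_list)
  from assms(1) have "apath x p1 x" "apath y p2 y"
    by (auto simp: p apath_append_iff apath_Cons_iff)
  then show ?thesis
    using apath_nonempty_ends p by blast
qed

end

section \<open>Symmetric closures of loopfree digraphs\<close>

lemma pair_bidirected_mk_symmetric: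
  assumes "loopfree_digraph H"
  shows "pair_bidirected_digraph (mk_symmetric H)"
proof -
  interpret H: loopfree_digraph H by fact
  interpret S: pair_wf_digraph "mk_symmetric H" by (rule H.wellformed_mk_symmetric)
  show ?thesis
    using H.no_loops symmetric_mk_symmetric[of H]
    by unfold_locales (fastforce simp: parcs_mk_symmetric)+
qed

lemma parcs_mk_symmetric_pair:
  assumes "tail H = fst" "head H = snd"
  shows "(x, y) \<in> parcs (mk_symmetric H) \<longleftrightarrow> (x, y) \<in> arcs H \<or> (y, x) \<in> arcs H"
  by (auto simp: parcs_mk_symmetric assms Bex_def)

lemma length_rev_path [simp]: "length (rev_path p) = length p"
  by (induction p) auto

lemma edges_of_Cons [simp]: "edges_of ((x, y) # p) = insert {x, y} (edges_of p)"
  by (auto simp: edges_of_def)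

section \<open>Unicyclic graphs with one edge removed\<close>

locale oriented_unicyclic =
  fixes G :: "'v pair_pre_digraph" and c :: "('v \<times> 'v) list"
  assumes oriented: "oriented_graph G"
    and unicyclic: "unicyclic (with_proj G)"
    and graph_cycle: "graph_cycle (with_proj G) c"
begin

sublocale G: pair_digraph G
  using oriented by (simp add: oriented_graph_def)

abbreviation U :: "'v pair_pre_digraph" where
  "U \<equiv> mk_symmetric (with_proj G)"

sublocale U: pair_bidirected_digraph U
  by (rule pair_bidirected_mk_symmetric) unfold_locales

lemma antisym_arcs: "(x, y) \<in> parcs G \<Longrightarrow> (y, x) \<notin> parcs G"
  using oriented by (simp add: oriented_graph_def)

lemma parcs_U: "(x, y) \<in> parcs U \<longleftrightarrow> (x, y) \<in> parcs G \<or> (y, x) \<in> parcs G"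
  by (simp add: parcs_mk_symmetric_pair)

lemma edges_of_graph_cycle: "graph_cycle (with_proj G) c' \<Longrightarrow> edges_of c' = edges_of c"
  using unicyclic graph_cycle unfolding unicyclic_def by blast

end

locale unicyclic_minus_arc = oriented_unicyclic G c
  for G :: "'v pair_pre_digraph" and c +
  fixes u v :: 'v
  assumes arc: "(u, v) \<in> parcs G"
begin

abbreviation H :: "('v, 'v \<times> 'v) pre_digraph" where
  "H \<equiv> pre_digraph.del_arc (with_proj G) (u, v)"

abbreviation S :: "'v pair_pre_digraph" where
  "S \<equiv> mk_symmetric H"

sublocale H: loopfree_digraph H
  using G.no_loops' G.wellformed'
  by unfold_locales (auto simp: pre_digraph.del_arc_simps)

sublocale S: pair_bidirected_digraph S
  by (rule pair_bidirected_mk_symmetric) unfold_locales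

lemma pverts_S [simp]: "pverts S = pverts G"
  by (simp add: pre_digraph.del_arc_simps)

text \<open>By orientation \<open>(v, u)\<close> is not an arc of \<open>G\<close>, so deleting
  \<open>(u, v)\<close> removes both directions from the symmetric closure.\<close>

lemma parcs_S: "parcs S = parcs U - {(u, v), (v, u)}"
proof -
  have "(x, y) \<in> parcs S \<longleftrightarrow> (x, y) \<in> parcs U - {(u, v), (v, u)}" for x y
    using antisym_arcs[OF arc] antisym_arcs[of x y] arc
    by (auto simp: parcs_mk_symmetric_pair parcs_U pre_digraph.del_arc_simps)
  then show ?thesis by auto
qed

lemma subgraph_S: "subgraph (with_proj S) (with_proj U)"
  by (rule subgraphI) (auto simp: parcs_S compatible_def pre_digraph.del_arc_simps, unfold_locales)

lemma graph_cycle_H_imp: "graph_cycle H c' \<Longrightarrow> graph_cycle (with_proj G) c'"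
  using U.subgraph_cycle[OF subgraph_S] by (simp add: graph_cycle_def)

lemma tree_at_iff:
  "S.tree_at s \<longleftrightarrow> (\<forall>x c. s \<rightarrow>\<^sup>*\<^bsub>with_proj S\<^esub> x \<longrightarrow> S.awalk x c x \<longrightarrow> \<not> graph_cycle H c)"
  unfolding S.tree_at_def graph_cycle_def by (meson not_le)

text \<open>Follow a walk from \<open>u\<close> in the whole graph; whenever it uses the deleted
  edge it arrives at \<open>u\<close> or \<open>v\<close>, and the argument restarts there.\<close>

lemma reachable_end:
  assumes "x \<in> pverts G"
  shows "u \<rightarrow>\<^sup>*\<^bsub>with_proj S\<^esub> x \<or> v \<rightarrow>\<^sup>*\<^bsub>with_proj S\<^esub> x"
proof -
  have uv: "u \<in> pverts G" "v \<in> pverts G"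
    using arc G.wellformed' by auto
  have "u \<rightarrow>\<^sup>*\<^bsub>with_proj U\<^esub> x"
    using unicyclic uv assms
    by (auto simp: unicyclic_def connected_def strongly_connected_def)
  then show ?thesis
  proof (induction rule: U.reachable_induct)
    case base
    then show ?case by (simp add: uv)
  next
    case (step x y)
    show ?case
    proof (cases "(x, y) \<in> parcs S")
      case True
      then show ?thesis
        using step.IH S.reachable_adj_trans by auto
    next
      case False
      then have "y = u \<or> y = v"
        using step.hyps(2) by (auto simp: parcs_S)
      then show ?thesis
        using uv by auto
    qed
  qed
qed

text \<open>A path joining the ends after deletion would close with the edge to a graph cycle, whose
  edges would have to be those of \<open>c\<close>.\<close>

lemma not_reachable_if_bridge:
  assumes "{u, v} \<notin> edges_of c"
  shows "\<not> u \<rightarrow>\<^sup>*\<^bsub>with_proj S\<^esub> v"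
proof
  assume "u \<rightarrow>\<^sup>*\<^bsub>with_proj S\<^esub> v"
  then obtain p where p: "S.apath v p u"
    using S.symmetric_reachable' S.reachable_apath by blast
  then have pU: "U.apath v p u"
    using U.subgraph_apath_imp_apath[OF _ subgraph_S] by simp
  have "u \<noteq> v"
    using arc G.no_loops' by blast
  \<comment> \<open>The only path of length 1 from \<open>v\<close> to \<open>u\<close> is the
    deleted arc, so \<open>p\<close> has at least two arcs and the closed walk at least
    three.\<close>
  have "(v, u) \<notin> set p"
    using p by (auto simp: S.apath_def S.awalk_def parcs_S)
  obtain a p' where "p = a # p'"
    using p \<open>u \<noteq> v\<close> by (cases p) (auto simp: S.apath_Nil_iff)
  moreover from this have "p' \<noteq> []"
    using p \<open>(v, u) \<notin> set p\<close> by (cases a) (auto simp: S.apath_simps)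
  ultimately have len: "3 \<le> length ((u, v) # p)"
    by (cases p') auto
  have "U.awalk u ((u, v) # p) u"
    using pU arc by (auto simp: U.awalk_Cons_iff U.apath_def parcs_U)
  moreover have "distinct (tl (pawalk_verts u ((u, v) # p)))"
    using pU by (simp add: U.apath_def)
  ultimately have "U.cycle ((u, v) # p)"
    unfolding U.cycle_def by blast
  with len have "graph_cycle (with_proj G) ((u, v) # p)"
    by (simp add: graph_cycle_def)
  from edges_of_graph_cycle[OF this] show False
    using assms by auto
qed

lemma edges_of_graph_cycle_H:
  assumes "graph_cycle H c'"
  shows "{u, v} \<notin> edges_of c'"
proof -
  from assms have "set c' \<subseteq> parcs S"
    by (auto simp: graph_cycle_def S.cycle_def S.awalk_def)
  then show ?thesis
    by (auto simp: parcs_S edges_of_def doubleton_eq_iff)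
qed

text \<open>All graph cycles of \<open>G\<close> have the edges of \<open>c\<close>, so none
  survives the deletion.\<close>

lemma tree_at_if_cycle_arc:
  assumes "{u, v} \<in> edges_of c"
  shows "S.tree_at s"
  using assms edges_of_graph_cycle_H edges_of_graph_cycle graph_cycle_H_imp
  unfolding tree_at_iff by blast

lemma graph_cycle_H:
  assumes "{u, v} \<notin> edges_of c"
  shows "graph_cycle H c"
proof -
  have c: "U.cycle c" "3 \<le> length c"
    using graph_cycle by (auto simp: graph_cycle_def)
  then obtain r where r: "U.awalk r c r" "distinct (tl (pawalk_verts r c))" "c \<noteq> []"
    unfolding U.cycle_def by auto
  have "(u, v) \<notin> set c" "(v, u) \<notin> set c"
    using assms by (force simp: edges_of_def)+
  then have "S.awalk r c r"
    using r(1) by (auto simp: S.awalk_def U.awalk_def parcs_S)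
  with r c show ?thesis
    unfolding graph_cycle_def S.cycle_def by blast
qed

text \<open>
  The cycle lies in one of the two components; two cycles in different components would have
  the same edges.
\<close>

lemma tree_at_tail_iff:
  assumes "{u, v} \<notin> edges_of c"
  shows "S.tree_at u \<longleftrightarrow> \<not> S.tree_at v"
proof
  assume "S.tree_at u"
  have gc: "graph_cycle H c"
    by (rule graph_cycle_H[OF assms])
  then obtain r where r: "S.awalk r c r"
    unfolding graph_cycle_def S.cycle_def by blast
  then have "r \<in> pverts G"
    using S.awalk_hd_in_verts by fastforce
  then show "\<not> S.tree_at v"
    using reachable_end r gc \<open>S.tree_at u\<close> unfolding tree_at_iff by blast
next
  assume "\<not> S.tree_at v"
  then obtain x d where d: "v \<rightarrow>\<^sup>*\<^bsub>with_proj S\<^esub> x" "S.awalk x d x" "graph_cycle H d"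
    unfolding tree_at_iff by blast
  show "S.tree_at u"
  proof (rule ccontr)
    assume "\<not> S.tree_at u"
    then obtain y d' where d': "u \<rightarrow>\<^sup>*\<^bsub>with_proj S\<^esub> y" "S.awalk y d' y" "graph_cycle H d'"
      unfolding tree_at_iff by blast
    have "edges_of d = edges_of d'"
      using d(3) d'(3) edges_of_graph_cycle graph_cycle_H_imp by blast
    moreover obtain a b ds where "d = (a, b) # ds"
      using d(3) by (cases d) (auto simp: graph_cycle_def)
    ultimately have ab: "(a, b) \<in> set d" and "{a, b} \<in> edges_of d'"
      by auto
    then have ab': "(a, b) \<in> set d' \<or> (b, a) \<in> set d'"
      by (auto simp: edges_of_def doubleton_eq_iff)
    have "x \<rightarrow>\<^sup>*\<^bsub>with_proj S\<^esub> a"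
      using S.awalk_verts_reachable_from[OF d(2)] S.awalk_verts_arc1[OF ab, of x] by simp
    moreover have "y \<rightarrow>\<^sup>*\<^bsub>with_proj S\<^esub> a"
      using S.awalk_verts_reachable_from[OF d'(2)] ab'
        S.awalk_verts_arc1[of "(a, b)" d' y] S.awalk_verts_arc2[OF d'(2), of "(b, a)"] by auto
    ultimately have "u \<rightarrow>\<^sup>*\<^bsub>with_proj S\<^esub> v"
      using d(1) d'(1) S.reachable_trans S.symmetric_reachable' by meson
    then show False
      using not_reachable_if_bridge[OF assms] by simp
  qed
qed

lemma verts_component_of: "verts (component_of H j) = {x. j \<rightarrow>\<^sup>*\<^bsub>with_proj S\<^esub> x}"
  using S.symmetric_reachable' by (auto simp: component_of_def S.scc_of_def)

text \<open>The component is connected, and each graph cycle in it is one of \<open>G\<close>, hence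
  has the edges of \<open>c\<close>. So unicyclicity reduces to the existence of a cycle. Walks
  starting in the component stay in it, so cycles can be moved between it and
  \<open>S\<close>.\<close>

lemma unicyclic_component_iff:
  assumes "j \<in> pverts G"
  shows "unicyclic (component_of H j) \<longleftrightarrow> \<not> S.tree_at j"
proof -
  let ?K = "component_of H j"
  have K: "verts ?K = {x. j \<rightarrow>\<^sup>*\<^bsub>with_proj S\<^esub> x}"
    by (rule verts_component_of)
  have lf: "loopfree_digraph ?K"
    unfolding component_of_def using H.no_loops by unfold_locales auto
  interpret T: pair_bidirected_digraph "mk_symmetric ?K"
    by (rule pair_bidirected_mk_symmetric[OF lf])
  have pvT: "pverts (mk_symmetric ?K) = {x. j \<rightarrow>\<^sup>*\<^bsub>with_proj S\<^esub> x}"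
    by (simp add: K)
  have parcs_T: "(x, y) \<in> parcs (mk_symmetric ?K) \<longleftrightarrow>
      (x, y) \<in> parcs S \<and> j \<rightarrow>\<^sup>*\<^bsub>with_proj S\<^esub> x \<and> j \<rightarrow>\<^sup>*\<^bsub>with_proj S\<^esub> y" for x y
    using K by (auto simp: parcs_mk_symmetric_pair component_of_def pre_digraph.del_arc_simps)
  have sub: "subgraph (with_proj (mk_symmetric ?K)) (with_proj S)"
  proof (rule subgraphI)
    show "verts (with_proj (mk_symmetric ?K)) \<subseteq> verts (with_proj S)"
      using S.reachable_in_verts by (auto simp: K)
    show "arcs (with_proj (mk_symmetric ?K)) \<subseteq> arcs (with_proj S)"
      using parcs_T by auto
  qed (auto, unfold_locales)
  have walk: "T.awalk x p y" if "S.awalk x p y" "j \<rightarrow>\<^sup>*\<^bsub>with_proj S\<^esub> x" for x p y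
    using that
  proof (induction p arbitrary: x)
    case Nil
    then show ?case by (auto simp: S.awalk_Nil_iff T.awalk_Nil_iff K)
  next
    case (Cons a p)
    then obtain z where a: "a = (x, z)" "(x, z) \<in> parcs S" "S.awalk z p y"
      by (cases a) (auto simp: S.awalk_Cons_iff)
    then have "j \<rightarrow>\<^sup>*\<^bsub>with_proj S\<^esub> z"
      using Cons.prems(2) S.reachable_adj_trans by auto
    with a Cons show ?case
      by (auto simp: T.awalk_Cons_iff parcs_T)
  qed
  have cyc: "graph_cycle ?K d \<longleftrightarrow>
      (\<exists>x. j \<rightarrow>\<^sup>*\<^bsub>with_proj S\<^esub> x \<and> S.awalk x d x \<and> graph_cycle H d)" for d
  proof
    assume d: "graph_cycle ?K d"
    then obtain x where x: "T.awalk x d x"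
      unfolding graph_cycle_def T.cycle_def by blast
    moreover have "S.cycle d"
      using S.subgraph_cycle[OF sub] d by (simp add: graph_cycle_def)
    ultimately show "\<exists>x. j \<rightarrow>\<^sup>*\<^bsub>with_proj S\<^esub> x \<and> S.awalk x d x \<and> graph_cycle H d"
      using d S.subgraph_awalk_imp_awalk[OF x sub] T.awalk_hd_in_verts[OF x]
      by (auto simp: graph_cycle_def K)
  next
    assume "\<exists>x. j \<rightarrow>\<^sup>*\<^bsub>with_proj S\<^esub> x \<and> S.awalk x d x \<and> graph_cycle H d"
    then obtain x where x: "j \<rightarrow>\<^sup>*\<^bsub>with_proj S\<^esub> x" "S.awalk x d x" and d: "graph_cycle H d"
      by blast
    \<comment> \<open>The vertex list of a nonempty arc list does not depend on the start vertex
      supplied.\<close>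
    have "distinct (tl (pawalk_verts x d))" "d \<noteq> []"
    proof -
      obtain y where "distinct (tl (pawalk_verts y d))" "d \<noteq> []"
        using d unfolding graph_cycle_def S.cycle_def by auto
      then show "distinct (tl (pawalk_verts x d))" "d \<noteq> []"
        by (cases d; simp)+
    qed
    then show "graph_cycle ?K d"
      using walk[OF x(2,1)] d unfolding graph_cycle_def T.cycle_def by blast
  qed
  have "Digraph_Component.connected ?K"
    unfolding connected_def
  proof (rule strongly_connectedI)
    show "verts (with_proj (mk_symmetric ?K)) \<noteq> {}"
    proof -
      have "j \<rightarrow>\<^sup>*\<^bsub>with_proj S\<^esub> j"
        using assms by simp
      then show ?thesis by (auto simp: K)
    qed
    fix x y
    assume xy: "x \<in> verts (with_proj (mk_symmetric ?K))" "y \<in> verts (with_proj (mk_symmetric ?K))"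
    then have "x \<rightarrow>\<^sup>*\<^bsub>with_proj S\<^esub> y"
      using S.reachable_trans S.symmetric_reachable' unfolding with_proj_simps pvT by blast
    then show "x \<rightarrow>\<^sup>*\<^bsub>with_proj (mk_symmetric ?K)\<^esub> y"
      using walk xy unfolding S.reachable_awalk T.reachable_awalk with_proj_simps pvT by blast
  qed
  moreover have "edges_of d = edges_of c" if "graph_cycle ?K d" for d
    using that cyc edges_of_graph_cycle graph_cycle_H_imp by blast
  ultimately have "unicyclic ?K \<longleftrightarrow> (\<exists>d. graph_cycle ?K d)"
    unfolding unicyclic_def by blast
  then show ?thesis
    unfolding tree_at_iff cyc by blast
qed

end

section \<open>Weights of walks\<close>

lemma walk_weight_append [simp]:
  "walk_weight G w (p @ q) = walk_weight G w p * walk_weight G w q"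
  by (simp add: walk_weight_def)

lemma walk_weight_Cons [simp]:
  "walk_weight G w ((x, y) # p) = adj_weight G w x y * walk_weight G w p"
  by (simp add: walk_weight_def)

lemma walk_weight_Nil [simp]: "walk_weight G w [] = 1"
  by (simp add: walk_weight_def)

lemma adj_weight_cnj:
  assumes "oriented_graph G"
  shows "adj_weight G w y x = cnj (adj_weight G w x y)"
  using assms by (auto simp: adj_weight_def oriented_graph_def)

lemma walk_weight_rev_path:
  assumes "oriented_graph G"
  shows "walk_weight G w (rev_path p) = cnj (walk_weight G w p)"
proof (induction p)
  case (Cons a p)
  then show ?case
    using adj_weight_cnj[OF assms, of w "snd a" "fst a"] by (cases a) simp
qed simp

text \<open>The sign and the normalised weight in an entry of \<open>F\<close>, merged into one
  quantity that is multiplicative along the path. For complex numbers \<open>sgn z\<close> is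
  \<open>z / \<bar>z\<bar>\<close>, and \<open>0\<close> at \<open>0\<close>.\<close>

definition signed_gain :: "'v pair_pre_digraph \<Rightarrow> ('v \<times> 'v \<Rightarrow> complex) \<Rightarrow> ('v \<times> 'v) list \<Rightarrow> complex" where
  "signed_gain G w p = (-1) ^ length p * sgn (walk_weight G w p)"

lemma signed_gain_Nil [simp]: "signed_gain G w [] = 1"
  by (simp add: signed_gain_def)

lemma signed_gain_snoc:
  "signed_gain G w (p @ [(x, y)]) = - (sgn (adj_weight G w x y) * signed_gain G w p)"
  by (simp add: signed_gain_def sgn_mult)

lemma sgn_mult_cnj: "z \<noteq> 0 \<Longrightarrow> sgn z * sgn (cnj z) = (1 :: complex)"
  by (simp add: complex_norm_square [symmetric] sgn_eq norm_power power2_eq_square flip: sgn_mult)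

text \<open>Reversing a path conjugates its weight, so this turns the inverse normalised weight of
  \<open>j\<close> to \<open>s\<close> into the normalised weight of \<open>s\<close> to
  \<open>j\<close>. At \<open>0\<close> both sides are \<open>0\<close>.\<close>

lemma cmod_divide_cnj: "complex_of_real (cmod z) / cnj z = sgn z"
proof (cases "z = 0")
  case False
  have "z * cnj z = complex_of_real (cmod z) * complex_of_real (cmod z)"
    by (simp add: complex_norm_square[symmetric] power2_eq_square[symmetric])
  with False show ?thesis
    by (simp add: sgn_eq field_simps)
qed simp

text \<open>Numbers of equal argument: in \<open>a = \<bar>a\<bar> * sgn a\<close> replace
  \<open>sgn a\<close> by \<open>sgn b\<close>, which cancels the argument of
  \<open>cnj b\<close>.\<close>

lemma mult_cnj_of_sgn_eq:
  assumes "sgn a = sgn b"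
  shows "a * cnj b = complex_of_real (cmod a * cmod b)"
proof (cases "a = 0 \<or> b = 0")
  case False
  then have "a = complex_of_real (cmod a) * sgn a"
    by (simp add: sgn_eq)
  then have "a * cnj b = complex_of_real (cmod a) * (sgn b * cnj b)"
    using assms by (metis mult.assoc)
  also have "sgn b * cnj b = complex_of_real (cmod b)"
    using False cmod_divide_cnj[of b] by (simp add: field_simps)
  finally show ?thesis by simp
qed auto

text \<open>The weights avoid the branch cut, so the principal root commutes with conjugation. For
  the second equation, \<open>sgn z\<close> is the square of \<open>sgn (csqrt z)\<close>: one
  factor turns the conjugate root into its modulus, the other turns the modulus into the
  root.\<close>

lemma csqrt_cnj_weight:
  fixes z :: complex
  assumes "z \<noteq> 0" "z \<notin> complex_of_real ` {..<0}"
  shows "csqrt (cnj z) = cnj (csqrt z)" "sgn z * cnj (csqrt z) = csqrt z"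
proof -
  have "z \<notin> \<real>\<^sub>\<le>\<^sub>0"
  proof
    assume "z \<in> \<real>\<^sub>\<le>\<^sub>0"
    then obtain r where "z = complex_of_real r" "r \<le> 0"
      by (elim nonpos_Reals_cases)
    with assms show False by (cases "r = 0") auto
  qed
  then show "csqrt (cnj z) = cnj (csqrt z)"
    by (simp add: cnj_csqrt)
  have "sgn z = sgn (csqrt z) * sgn (csqrt z)"
    by (metis power2_csqrt power2_eq_square sgn_mult)
  moreover have "sgn (csqrt z) * cnj (csqrt z) = complex_of_real (cmod (csqrt z))"
    using assms(1) cmod_divide_cnj[of "csqrt z"] by (simp add: field_simps del: norm_csqrt)
  moreover have "sgn (csqrt z) * complex_of_real (cmod (csqrt z)) = csqrt z"
    using assms(1) by (simp add: sgn_eq del: norm_csqrt)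
  ultimately show "sgn z * cnj (csqrt z) = csqrt z"
    by (simp add: mult.assoc)
qed

section \<open>Gains along tree paths and the weight of the cycle\<close>

context unicyclic_minus_arc
begin

text \<open>Uniqueness of paths evaluates the \<open>THE\<close> and \<open>LEAST\<close> in the
  definitions to any path at hand, in both directions.\<close>

lemma path_dist:
  assumes "S.tree_at s" "S.apath s p r"
  shows "path_in H s r = p" "path_in H r s = rev_path p"
    "dist_in H s r = length p" "dist_in H r s = length p"
proof -
  have "s \<rightarrow>\<^sup>*\<^bsub>with_proj S\<^esub> r"
    using assms(2) S.reachable_apath by blast
  then have r: "S.tree_at r" "S.apath r (rev_path p) s"
    using S.tree_at_reachable assms by auto
  show "path_in H s r = p" "path_in H r s = rev_path p"
    using S.the_apath[OF assms] S.the_apath[OF r] by (simp_all add: path_in_def)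
  show "dist_in H s r = length p" "dist_in H r s = length p"
    using S.Least_length_awalk[OF assms] S.Least_length_awalk[OF r] by (simp_all add: dist_in_def)
qed

lemma apath_path_in:
  assumes "S.tree_at s" "s \<rightarrow>\<^sup>*\<^bsub>with_proj S\<^esub> r"
  shows "S.apath s (path_in H s r) r"
  using assms path_dist(1) S.reachable_apath by metis

text \<open>If the path to \<open>y\<close> prolongs the path to \<open>x\<close>, this is one more
  factor. Otherwise the last factor is undone: the gain of the reverse arc is the conjugate, hence
  the inverse, of a unit number.\<close>

lemma signed_gain_step:
  assumes "S.tree_at s" "s \<rightarrow>\<^sup>*\<^bsub>with_proj S\<^esub> x" "(x, y) \<in> parcs S" "adj_weight G w x y \<noteq> 0"
  shows "signed_gain G w (path_in H s y)
    = - (sgn (adj_weight G w x y) * signed_gain G w (path_in H s x))"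
  using S.apath_arc_cases[OF assms(1) apath_path_in[OF assms(1,2)] assms(3)]
proof cases
  case 1
  then show ?thesis
    by (simp add: path_dist(1)[OF assms(1)] signed_gain_snoc)
next
  case (2 q)
  then show ?thesis
    using sgn_mult_cnj[OF assms(4)] adj_weight_cnj[OF oriented, of w y x]
    by (simp add: path_dist(1)[OF assms(1)] signed_gain_snoc)
qed

text \<open>The two forms match the entries of \<open>F\<close> for an edge on the cycle and off
  it.\<close>

lemma signed_gain_path_in:
  assumes "S.tree_at s" "s \<rightarrow>\<^sup>*\<^bsub>with_proj S\<^esub> j"
  shows "signed_gain G w (path_in H s j)
      = (-1) ^ dist_in H j s * sgn (walk_weight G w (path_in H s j))"
    and "signed_gain G w (path_in H s j)
      = (-1) ^ dist_in H j s
        * (complex_of_real (cmod (walk_weight G w (path_in H j s))) / walk_weight G w (path_in H j s))"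
  using path_dist[OF assms(1) apath_path_in[OF assms]]
  by (simp_all add: signed_gain_def walk_weight_rev_path[OF oriented] cmod_divide_cnj)

text \<open>The path is the rest of the cycle. The first alternative arises when \<open>c\<close>
  traverses the edge from \<open>u\<close> to \<open>v\<close>, so that the rest must be reversed;
  the second when it traverses the edge backwards.\<close>

lemma cycle_arc_path:
  assumes "{u, v} \<in> edges_of c"
  obtains p where "S.apath u p v" "length c = Suc (length p)"
    "walk_weight G w c = w (u, v) * cnj (walk_weight G w p) \<or>
     walk_weight G w c = cnj (w (u, v)) * walk_weight G w p"
proof -
  have c: "U.cycle c" "3 \<le> length c"
    using graph_cycle by (auto simp: graph_cycle_def)
  obtain x y where xy: "(x, y) \<in> set c" "{x, y} = {u, v}"
    using assms by (auto simp: edges_of_def)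
  then obtain p1 p2 where p12: "c = p1 @ (x, y) # p2"
    by (meson split_list)
  let ?q = "p2 @ p1"
  have q: "U.apath y ?q x"
    using U.cycle_minus_arc c(1) p12 by blast
  have len: "length c = Suc (length ?q)"
    by (simp add: p12)
  have "(x, y) \<notin> set ?q"
    using c(1) unfolding U.cycle_conv p12 by auto
  \<comment> \<open>Otherwise the rest would be this arc alone and the cycle would have length
    2.\<close>
  moreover have "(y, x) \<notin> set ?q"
  proof
    assume "(y, x) \<in> set ?q"
    from U.apath_containing_arc[OF q this] have "length ?q = 1"
      by (simp only: list.size)
    with len c(2) show False by simp
  qed
  moreover have "(u, v) = (x, y) \<and> (v, u) = (y, x) \<or> (u, v) = (y, x) \<and> (v, u) = (x, y)"
    using xy(2) by (auto simp: doubleton_eq_iff)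
  ultimately have "(u, v) \<notin> set ?q" "(v, u) \<notin> set ?q"
    by auto
  then have qS: "S.apath y ?q x"
    using q unfolding S.apath_def U.apath_def S.awalk_def U.awalk_def
    by (auto simp: parcs_S pre_digraph.del_arc_simps)
  have wt: "walk_weight G w c = adj_weight G w x y * walk_weight G w ?q"
    by (simp add: p12 mult_ac)
  consider "x = u" "y = v" | "x = v" "y = u"
    using xy(2) by (auto simp: doubleton_eq_iff)
  then show ?thesis
  proof cases
    case 1
    show ?thesis
    proof (rule that)
      show "S.apath u (rev_path ?q) v"
        using qS 1 by (simp del: rev_path_append)
    qed (use len wt arc in \<open>auto simp: 1 adj_weight_def walk_weight_rev_path[OF oriented]
           simp del: rev_path_append\<close>)
  next
    case 2
    show ?thesis
      by (rule that[OF qS[unfolded 2]]) (use len wt arc antisym_arcs in \<open>auto simp: 2 adj_weight_def\<close>)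
  qed
qed

text \<open>
  If the two unit complex numbers agreed, the weight of the cycle would be the positive real
  \<open>\<bar>w(u, v)\<bar> * \<bar>wt p\<bar>\<close>, where \<open>p\<close> is the path from \<open>u\<close> to \<open>v\<close>.
\<close>

lemma sgn_weight_neq:
  assumes "{u, v} \<in> edges_of c" "w (u, v) \<noteq> 0"
    and "walk_weight G w c \<notin> complex_of_real ` {0<..}"
  shows "sgn (w (u, v)) \<noteq> sgn (walk_weight G w (path_in H u v))"
proof
  obtain p where p: "S.apath u p v"
    "walk_weight G w c = w (u, v) * cnj (walk_weight G w p) \<or>
     walk_weight G w c = cnj (w (u, v)) * walk_weight G w p"
    using cycle_arc_path[OF assms(1)] by metis
  let ?a = "w (u, v)" and ?b = "walk_weight G w p"
  assume "sgn ?a = sgn (walk_weight G w (path_in H u v))"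
  then have eq: "sgn ?a = sgn ?b"
    using path_dist(1)[OF tree_at_if_cycle_arc[OF assms(1)] p(1)] by simp
  then have "?b \<noteq> 0"
    using assms(2) by (metis sgn_zero_iff)
  have "walk_weight G w c = complex_of_real (cmod ?a * cmod ?b)"
    using p(2) mult_cnj_of_sgn_eq[OF eq] mult_cnj_of_sgn_eq[OF eq[symmetric]]
    by (auto simp: mult.commute)
  then show False
    using assms(2,3) \<open>?b \<noteq> 0\<close> by (auto simp del: of_real_mult)
qed

end

section \<open>The product of \<open>F\<close> and the incidence matrix\<close>

lemma mult_signless_incidence:
  fixes e :: "'e::finite \<Rightarrow> 'v::finite \<times> 'v"
  assumes "e k = (x, y)" "x \<noteq> y"
  shows "(A ** signless_incidence e w) $ i $ k
    = A $ i $ x * csqrt (w (x, y)) + A $ i $ y * csqrt (cnj (w (x, y)))"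
proof -
  have "(A ** signless_incidence e w) $ i $ k = (\<Sum>j\<in>UNIV. A $ i $ j * (signless_incidence e w $ j $ k))"
    by (simp add: matrix_matrix_mult_def)
  also have "\<dots> = (\<Sum>j\<in>UNIV. (if j = x then A $ i $ x * csqrt (w (x, y)) else 0)
      + (if j = y then A $ i $ y * csqrt (cnj (w (x, y))) else 0))"
    using assms by (intro sum.cong) (auto simp: signless_incidence_def)
  also have "\<dots> = A $ i $ x * csqrt (w (x, y)) + A $ i $ y * csqrt (cnj (w (x, y)))"
    by (simp add: sum.distrib)
  finally show ?thesis .
qed

text \<open>The entry of \<open>F N\<close> in the row of \<open>(u, v)\<close> and the column of
  \<open>(x, y)\<close>, by \<open>mult_signless_incidence\<close>.\<close>

lemma F_matrix_incidence_entry: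
  fixes G :: "'v::finite pair_pre_digraph" and e :: "'e::finite \<Rightarrow> 'v \<times> 'v"
  assumes "unicyclic_minus_arc G c u v" and pv: "pverts G = UNIV" and ev: "even (length c)"
    and w: "\<And>a. a \<in> parcs G \<Longrightarrow> w a \<noteq> 0 \<and> w a \<notin> complex_of_real ` {..<0}"
    and wc: "walk_weight G w c \<notin> complex_of_real ` {0<..}"
    and e: "e i = (u, v)" and xy: "(x, y) \<in> parcs G"
  shows "F_matrix G w e c $ i $ x * csqrt (w (x, y)) + F_matrix G w e c $ i $ y * csqrt (cnj (w (x, y)))
    = (if (x, y) = (u, v) then 1 else 0)"
proof -
  interpret unicyclic_minus_arc G c u v by fact
  let ?g = "\<lambda>s j. signed_gain G w (path_in H s j)"
  let ?R = "\<lambda>x y. x \<rightarrow>\<^sup>*\<^bsub>with_proj S\<^esub> y"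
  let ?K = "csqrt (cnj (w (u, v))) * (sgn (w (u, v)) - sgn (walk_weight G w (path_in H u v)))"
  have R: "?R u j \<or> ?R v j" for j
    using reachable_end pv by simp
  have sym: "?R b a" if "?R a b" for a b
    using that by (rule S.symmetric_reachable')
  \<comment> \<open>The rest of the cycle still joins \<open>u\<close> and \<open>v\<close>, so the
    whole graph minus the edge is one tree rooted at \<open>u\<close>.\<close>
  have cyc_R: "?R u j" if cyc: "{u, v} \<in> edges_of c" for j
  proof -
    have "?R u v"
      using cycle_arc_path[OF cyc] S.reachable_apath by metis
    then show ?thesis
      using R[of j] S.reachable_trans by blast
  qed
  \<comment> \<open>All branches of \<open>F\<close> become a gain from an end of the edge divided
    by a constant, or \<open>0\<close>. A vertex of a tree component not reached from
    \<open>u\<close> is reached from \<open>v\<close>.\<close>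
  have F: "F_matrix G w e c $ i $ j =
      (if {u, v} \<in> edges_of c then ?g u j / ?K
       else if \<not> S.tree_at j then 0
       else if ?R u j then ?g u j / csqrt (w (u, v))
       else ?g v j / csqrt (cnj (w (u, v))))" for j
  proof (cases "{u, v} \<in> edges_of c")
    case True
    then show ?thesis
      using signed_gain_path_in(1)[OF tree_at_if_cycle_arc[OF True] cyc_R[OF True], of w j]
      by (simp add: F_matrix_def e Let_def sgn_eq)
  next
    case False
    have u: "u \<in> verts (component_of H j) \<longleftrightarrow> ?R u j"
      using sym by (auto simp: verts_component_of)
    have j: "unicyclic (component_of H j) \<longleftrightarrow> \<not> S.tree_at j"
      using unicyclic_component_iff pv by simp
    consider "\<not> S.tree_at j" | "S.tree_at j" "?R u j" "S.tree_at u"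
      | "S.tree_at j" "\<not> ?R u j" "?R v j" "S.tree_at v"
      using R[of j] sym S.tree_at_reachable by blast
    then show ?thesis
    proof cases
      case 1
      then show ?thesis
        using False by (simp add: F_matrix_def e Let_def j)
    next
      case 2
      then show ?thesis
        using False signed_gain_path_in(2)[OF 2(3,2), of w] by (simp add: F_matrix_def e Let_def j u)
    next
      case 3
      then show ?thesis
        using False signed_gain_path_in(2)[OF 3(4,3), of w] by (simp add: F_matrix_def e Let_def j u)
    qed
  qed
  have g_self: "?g s s = 1" if "S.tree_at s" for s
    using path_dist(1)[OF that, of "[]" s] by (simp add: S.apath_Nil_iff pv)
  have wuv: "w (u, v) \<noteq> 0" "w (u, v) \<notin> complex_of_real ` {..<0}"
    using w arc by auto
  note sq = csqrt_cnj_weight[OF wuv]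
  show ?thesis
  proof (cases "(x, y) = (u, v)")
    case True
    show ?thesis
    proof (cases "{u, v} \<in> edges_of c")
      case cyc: True
      obtain p where p: "S.apath u p v" "length c = Suc (length p)"
        using cycle_arc_path[OF cyc] by metis
      note T = tree_at_if_cycle_arc[OF cyc, of u]
      \<comment> \<open>As \<open>c\<close> is even, the path from \<open>u\<close> to
        \<open>v\<close> has odd length, whence the minus sign.\<close>
      have gv: "?g u v = - sgn (walk_weight G w (path_in H u v))"
        using ev p(2) by (simp add: signed_gain_def path_dist(1)[OF T p(1)])
      have "?K \<noteq> 0"
        using sgn_weight_neq[OF cyc wuv(1) wc] wuv by simp
      \<comment> \<open>Writing the root of the weight as \<open>sgn\<close> times its conjugate
        lets the conjugate root be factored out, which leaves exactly the denominator of
        \<open>F\<close>.\<close>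
      have "csqrt (w (u, v)) + ?g u v * csqrt (cnj (w (u, v))) = ?K"
        unfolding gv sq(1) right_diff_distrib by (subst sq(2)[symmetric]) (simp add: mult_ac)
      moreover have "?g u u / ?K * csqrt (w (u, v)) + ?g u v / ?K * csqrt (cnj (w (u, v)))
          = (csqrt (w (u, v)) + ?g u v * csqrt (cnj (w (u, v)))) / ?K"
        by (simp only: g_self[OF T] add_divide_distrib) simp
      ultimately show ?thesis
        using True cyc \<open>?K \<noteq> 0\<close> by (simp only: F if_True prod.inject refl simp_thms) simp
    next
      case False
      \<comment> \<open>Exactly one of \<open>u\<close> and \<open>v\<close> lies in a tree
        component. Its summand is \<open>1\<close>, since the empty path has gain \<open>1\<close>;
        the other summand is \<open>0\<close>.\<close>
      have "?R u u"
        using pv by simp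
      moreover have "\<not> ?R u v"
        using not_reachable_if_bridge False by blast
      ultimately show ?thesis
        using True False wuv tree_at_tail_iff[OF False] g_self by (auto simp: F)
    qed
  next
    case False
    then have S: "(x, y) \<in> parcs S"
      using xy antisym_arcs[OF arc] by (auto simp: parcs_S parcs_U)
    then have xR: "?R x y"
      by simp
    note wxy = w[OF xy] csqrt_cnj_weight[of "w (x, y)"]
    \<comment> \<open>The recurrence makes the second summand \<open>- sgn w * cnj (csqrt w)\<close>
      times the gain at \<open>x\<close>, which cancels the first.\<close>
    have step: "?g s x * csqrt (w (x, y)) + ?g s y * csqrt (cnj (w (x, y))) = 0"
      if "S.tree_at s" "?R s x" for s
    proof -
      have "?g s y = - (sgn (w (x, y)) * ?g s x)"
        using signed_gain_step[OF that S, of w] xy wxy by (simp add: adj_weight_def)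
      then show ?thesis
        using wxy by (simp add: mult.assoc mult.left_commute)
    qed
    have zero: "a / k * b + a' / k * b' = 0" if "a * b + a' * b' = 0" for a a' b b' k :: complex
      using that by (simp flip: add_divide_distrib)
    \<comment> \<open>Both ends of a surviving edge lie in the same component, so they fall under
      the same branch of \<open>F\<close>.\<close>
    have iffs: "S.tree_at x \<longleftrightarrow> S.tree_at y" "?R u x \<longleftrightarrow> ?R u y"
      using xR sym S.tree_at_reachable S.reachable_trans by blast+
    consider "{u, v} \<in> edges_of c" | "{u, v} \<notin> edges_of c" "\<not> S.tree_at x"
      | "{u, v} \<notin> edges_of c" "S.tree_at x" "?R u x" "S.tree_at u"
      | "{u, v} \<notin> edges_of c" "S.tree_at x" "\<not> ?R u x" "?R v x" "S.tree_at v"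
      using R[of x] sym S.tree_at_reachable by blast
    then show ?thesis
    proof cases
      case 1
      then show ?thesis
        using False zero[OF step[OF tree_at_if_cycle_arc cyc_R]] by (simp only: F if_True if_False)
    next
      case 2
      then show ?thesis
        using False iffs by (auto simp: F)
    next
      case 3
      then show ?thesis
        using False iffs zero[OF step[OF 3(4,3)]] by (simp only: F if_True if_False simp_thms)
    next
      case 4
      then show ?thesis
        using False iffs zero[OF step[OF 4(5,4)]] by (simp only: F if_True if_False simp_thms)
    qed
  qed
qed

text \<open>A left inverse of a square matrix is two-sided, and the identity is
  self-adjoint.\<close>

lemma moore_penrose_inverse_of_inverse:
  fixes A X :: "complex ^ 'n::finite ^ 'n"
  assumes "X ** A = mat 1"
  shows "is_moore_penrose_inverse A X"
proof -
  have "A ** X = mat 1"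
    using assms matrix_left_right_inverse by blast
  moreover have "conj_transpose (mat 1 :: complex ^ 'n ^ 'n) = mat 1"
    by (simp add: conj_transpose_def mat_def vec_eq_iff)
  ultimately show ?thesis
    using assms by (simp add: is_moore_penrose_inverse_def)
qed

theorem theorem3p4:
  fixes G :: "'n::finite pair_pre_digraph"
    and e :: "'n \<Rightarrow> 'n \<times> 'n"
    and w :: "'n \<times> 'n \<Rightarrow> complex"
    and c :: "('n \<times> 'n) list"
  assumes "CARD('n) \<ge> 2"
    and "oriented_graph G" and "pverts G = UNIV"
    and "bij_betw e UNIV (parcs G)"
    and "unicyclic (with_proj G)"
    and "graph_cycle (with_proj G) c" and "even (length c)"
    and "\<And>a. a \<in> parcs G \<Longrightarrow> w a \<noteq> 0 \<and> w a \<notin> complex_of_real ` {..<0}"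
    and "walk_weight G w c \<notin> complex_of_real ` {0<..}"
  shows "is_moore_penrose_inverse (signless_incidence e w) (F_matrix G w e c)"
proof (rule moore_penrose_inverse_of_inverse)
  interpret oriented_unicyclic G c
    using assms(2,5,6) by unfold_locales
  have arcs: "e i \<in> parcs G" for i
    using assms(4) by (auto simp: bij_betw_def)
  \<comment> \<open>Distinct indices name distinct edges, so comparing edges is comparing the row
    and column indices of the identity matrix.\<close>
  have inj: "e i = e k \<longleftrightarrow> i = k" for i k
    using assms(4) by (auto simp: bij_betw_def inj_eq)
  have "(F_matrix G w e c ** signless_incidence e w) $ i $ k = (if i = k then 1 else 0)" for i k
  proof -
    obtain u v x y where uv: "e i = (u, v)" and xy: "e k = (x, y)"
      by fastforce
    have "(u, v) \<in> parcs G" "(x, y) \<in> parcs G"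
      using arcs[of i] arcs[of k] uv xy by auto
    then have "unicyclic_minus_arc G c u v"
      by unfold_locales
    then have "F_matrix G w e c $ i $ x * csqrt (w (x, y)) + F_matrix G w e c $ i $ y * csqrt (cnj (w (x, y)))
        = (if (x, y) = (u, v) then 1 else 0)"
      by (rule F_matrix_incidence_entry) (use assms uv \<open>(x, y) \<in> parcs G\<close> in auto)
    moreover have "x \<noteq> y"
      using \<open>(x, y) \<in> parcs G\<close> G.no_loops' by blast
    moreover have "(x, y) = (u, v) \<longleftrightarrow> i = k"
      using inj[of i k] uv xy by auto
    ultimately show ?thesis
      using xy mult_signless_incidence[of e k x y "F_matrix G w e c" w i] by simp
  qed
  then show "F_matrix G w e c ** signless_incidence e w = mat 1"
    by (simp add: vec_eq_iff mat_def)
qed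

end
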